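(* Consider a given instance of a single-machine scheduling problem with a min-sum non-decreasing objective function, with set of jobs $\mathcal{N}=\{1,\ldots,n\}$, planning horizon $\mathcal{T}=\{0,1,\ldots,T-1\}$, job processing times $\{p_j\}_{j\in\mathcal{N}}$, job release times $\{r_j\}_{j\in\mathcal{N}}$, and starting costs $\{c_{jt}\}_{j\in\mathcal{N},t\in\mathcal{T}}$. Suppose that $\{S_1,\ldots,S_n\}$ are the starting times of the jobs in an optimal solution of this instance. Let $\alpha$ be a positive integer, and consider a larger instance of the same kind with the same set of jobs $\mathcal{N}$, with planning horizon $\mathcal{T}'=\{0,1,\ldots,\alpha(T-1)\}$, processing times $p_j'=\alpha p_j$ and release times $r_j'=\alpha r_j$ for all $j\in\mathcal{N}$ (other parameters of the instance, such as due dates or weights, may also be changed), and with resulting starting costs $\{c'_{jt}\}_{j\in\mathcal{N},t\in\mathcal{T}'}$. If there exists a scalar $\beta$ such that $$c'_{j,\alpha t}=\beta\cdot c_{jt}\qquad\text{for all } j\in\mathcal{N},\ t\in\mathcal{T},$$ then using $\{\alpha S_1,\ldots,\alpha S_n\}$ as the starting times of the jobs gives an optimal solution to the larger instance.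
   Context: Single-machine min-sum scheduling. An instance consists of a finite set of jobs $\mathcal{N}=\{1,\ldots,n\}$, processing times $p_j$ (positive integers), release times $r_j$ (non-negative integers; all zero for a problem without release times), and for each job $j$ a real-valued cost function $z_j$ that is non-decreasing in the completion time of the job (different jobs may have different cost functions, which may depend on further parameters such as weights or due dates). The machine processes at most one job at a time and jobs are processed without preemption: a job started at time $t$ occupies the machine during $[t,t+p_j)$ and completes at $C_j=t+p_j$. The planning horizon is a set of consecutive integer time points beginning with $0$, at which jobs may be started. For the given instance it is $\mathcal{T}=\{0,\ldots,T-1\}$, where $T$ is assumed large enough that, for every order of the jobs, the schedule that starts each job as early as possible in that order (no unnecessary inserted idle time) completes all jobs by time $T$. The starting cost of job $j$ at time $t$ is its cost if it is started at time $t$: $c_{jt}=z_j(t+p_j)$ for $t\in\mathcal{T}$. For the larger instance, with non-decreasing cost functions $z'_j$, it is $c'_{jt}=z'_j(t+p'_j)$ for $t\in\mathcal{T}'$. In particular, $c_{jt}$ and $c'_{jt}$ are non-decreasing in $t$. A feasible solution of an instance is an assignment to each job $j$ of a starting time $S_j$ in the planning horizon such that $S_j\ge r_j$ for all $j$ and the intervals $[S_j,S_j+p_j)$, $j\in\mathcal{N}$, are pairwise disjoint (with $p_j,r_j$ replaced by $p_j',r_j'$ for the larger instance). Its objective value is $\sum_{j\in\mathcal{N}} c_{j,S_j}$ (respectively $\sum_{j\in\mathcal{N}} c'_{j,S_j}$). An optimal solution is a feasible solution of minimum objective value. *)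

theory Defs
  imports Complex_Main "HOL-Library.Disjoint_Sets"
begin

text \<open>Integer time points are natural numbers. The last field gives, for every job, its cost
  as a function of its completion time; weights, due dates and the like are subsumed in it.\<close>

record sched_instance =
  num_jobs :: nat
  horizon :: "nat set"
  proc_time :: "nat \<Rightarrow> nat"
  release :: "nat \<Rightarrow> nat"
  completion_cost :: "nat \<Rightarrow> nat \<Rightarrow> real"

definition jobs :: "sched_instance \<Rightarrow> nat set" where
  "jobs I = {1..num_jobs I}"

definition valid_instance :: "sched_instance \<Rightarrow> bool" where
  "valid_instance I \<longleftrightarrow>
     (\<exists>m. horizon I = {0..m}) \<and>
     (\<forall>j\<in>jobs I. proc_time I j > 0 \<and> mono (completion_cost I j))"

definition start_cost :: "sched_instance \<Rightarrow> nat \<Rightarrow> nat \<Rightarrow> real" where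
  "start_cost I j t = completion_cost I j (t + proc_time I j)"

text \<open>A solution is a function giving the starting time of each job; its values outside
  \<^term>\<open>jobs I\<close> are irrelevant.\<close>

definition feasible :: "sched_instance \<Rightarrow> (nat \<Rightarrow> nat) \<Rightarrow> bool" where
  "feasible I S \<longleftrightarrow>
     (\<forall>j\<in>jobs I. S j \<in> horizon I \<and> release I j \<le> S j) \<and>
     disjoint_family_on (\<lambda>j. {real (S j)..<real (S j + proc_time I j)}) (jobs I)"

definition objective :: "sched_instance \<Rightarrow> (nat \<Rightarrow> nat) \<Rightarrow> real" where
  "objective I S = (\<Sum>j\<in>jobs I. start_cost I j (S j))"

definition optimal :: "sched_instance \<Rightarrow> (nat \<Rightarrow> nat) \<Rightarrow> bool" where
  "optimal I S \<longleftrightarrow> is_arg_min (objective I) (feasible I) S"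

text \<open>Starting times when the jobs in the list are processed in that order, each as early as
  possible, on a machine that becomes available at time \<open>t\<close>.\<close>

primrec earliest_starts :: "sched_instance \<Rightarrow> nat \<Rightarrow> nat list \<Rightarrow> nat list" where
  "earliest_starts I t [] = []"
| "earliest_starts I t (j # js) =
     (let s = max t (release I j) in s # earliest_starts I (s + proc_time I j) js)"

definition completes_every_order_by :: "sched_instance \<Rightarrow> nat \<Rightarrow> bool" where
  "completes_every_order_by I T \<longleftrightarrow>
     (\<forall>js. distinct js \<and> set js = jobs I \<longrightarrow>
        (\<forall>k<length js. earliest_starts I 0 js ! k + proc_time I (js ! k) \<le> T))"

end

theory Submission imports Defs begin

text \<open>Multiplying all starting times of the given instance by \<open>\<alpha>\<close> yields a schedule of the larger
  instance. In the opposite direction, every schedule \<open>S'\<close> of the larger instance can be rounded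
  down to the schedule \<open>S' div \<alpha>\<close> of the given one: a lower bound \<open>x + \<alpha> * p \<le> y\<close> on a
  starting time \<open>y\<close> survives the rounding as \<open>x div \<alpha> + p \<le> y div \<alpha>\<close>, and both release times and
  precedences between jobs on the machine are bounds of this form
  (\<open>feasible_scale_up\<close>, \<open>feasible_scale_down\<close>).

  Let \<open>\<beta> \<ge> 0\<close>. Rounding down \<open>S'\<close> to the multiples \<open>\<alpha> * (S' div \<alpha>)\<close> does not increase the cost.
  On multiples of \<open>\<alpha>\<close> the cost in the larger instance is \<open>\<beta>\<close> times the cost in the given
  instance, where \<open>S\<close> is at most as expensive as \<open>S' div \<alpha>\<close>. Hence \<open>\<alpha> * S\<close> is at most as
  expensive as \<open>S'\<close>.

  A negative \<open>\<beta>\<close> reverses the comparison of \<open>S\<close> with \<open>S' div \<alpha>\<close>. In that case, however, the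
  starting costs of the larger instance are both non-decreasing and, along multiples of \<open>\<alpha>\<close>,
  non-increasing, so that no job can cost less than it does at \<open>\<alpha> * S\<close>.\<close>

text \<open>Half-open real intervals with integer end points are disjoint only if one ends before the
  other begins, since otherwise the larger left end point lies in both. An empty
  interval is disjoint from every set, hence the positive lengths.\<close>

lemma disjoint_nat_intervals_iff:
  fixes a b p q :: nat
  assumes "p > 0" "q > 0"
  shows "{real a..<real (a + p)} \<inter> {real b..<real (b + q)} = {} \<longleftrightarrow> a + p \<le> b \<or> b + q \<le> a"
proof
  assume "{real a..<real (a + p)} \<inter> {real b..<real (b + q)} = {}"
  then have "real (max a b) \<notin> {real a..<real (a + p)} \<inter> {real b..<real (b + q)}"
    by blast
  with assms show "a + p \<le> b \<or> b + q \<le> a"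
    by (auto simp: max_def split: if_splits)
qed auto

lemma feasible_iff_sequential:
  assumes "valid_instance I"
  shows "feasible I S \<longleftrightarrow>
    (\<forall>j\<in>jobs I. S j \<in> horizon I \<and> release I j \<le> S j) \<and>
    (\<forall>i\<in>jobs I. \<forall>j\<in>jobs I. i \<noteq> j \<longrightarrow>
       S i + proc_time I i \<le> S j \<or> S j + proc_time I j \<le> S i)"
proof -
  have "{real (S i)..<real (S i + proc_time I i)} \<inter> {real (S j)..<real (S j + proc_time I j)} = {}
      \<longleftrightarrow> S i + proc_time I i \<le> S j \<or> S j + proc_time I j \<le> S i"
    if "i \<in> jobs I" "j \<in> jobs I" for i j
    using that assms by (intro disjoint_nat_intervals_iff) (auto simp: valid_instance_def)
  then show ?thesis
    unfolding feasible_def disjoint_family_on_def by blast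
qed

lemma start_cost_mono:
  assumes "valid_instance I" "j \<in> jobs I" "s \<le> t"
  shows "start_cost I j s \<le> start_cost I j t"
  using assms by (auto simp: valid_instance_def start_cost_def intro: monoD)

lemma feasible_scale_up:
  assumes "valid_instance I" "valid_instance I'" "jobs I' = jobs I"
    and "\<And>t. t \<in> horizon I \<Longrightarrow> \<alpha> * t \<in> horizon I'"
    and proc: "\<And>j. j \<in> jobs I \<Longrightarrow> proc_time I' j = \<alpha> * proc_time I j"
    and "\<And>j. j \<in> jobs I \<Longrightarrow> release I' j = \<alpha> * release I j"
    and "feasible I S"
  shows "feasible I' (\<lambda>j. \<alpha> * S j)"
proof -
  have "\<alpha> * S i + proc_time I' i \<le> \<alpha> * S j"
    if "i \<in> jobs I" "S i + proc_time I i \<le> S j" for i j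
    using mult_le_mono2[OF that(2), of \<alpha>] that(1) by (simp add: proc distrib_left)
  with assms show ?thesis
    by (simp add: feasible_iff_sequential) blast
qed

text \<open>Rounding down keeps jobs apart because processing and release times of the larger instance
  are multiples of \<open>\<alpha>\<close>.\<close>

lemma feasible_scale_down:
  assumes "valid_instance I" "valid_instance I'" "jobs I' = jobs I" "\<alpha> > 0"
    and "\<And>t. t \<in> horizon I' \<Longrightarrow> t div \<alpha> \<in> horizon I"
    and proc: "\<And>j. j \<in> jobs I \<Longrightarrow> proc_time I' j = \<alpha> * proc_time I j"
    and rel: "\<And>j. j \<in> jobs I \<Longrightarrow> release I' j = \<alpha> * release I j"
    and "feasible I' S'"
  shows "feasible I (\<lambda>j. S' j div \<alpha>)"
proof -
  have "S' i div \<alpha> + proc_time I i \<le> S' j div \<alpha>"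
    if "i \<in> jobs I" "S' i + proc_time I' i \<le> S' j" for i j
    using div_le_mono[OF that(2), of \<alpha>] that(1) \<open>\<alpha> > 0\<close> by (simp add: proc)
  moreover have "release I j \<le> S' j div \<alpha>" if "j \<in> jobs I" "release I' j \<le> S' j" for j
    using div_le_mono[OF that(2), of \<alpha>] that(1) \<open>\<alpha> > 0\<close> by (simp add: rel)
  ultimately show ?thesis
    using assms by (simp add: feasible_iff_sequential) blast
qed

theorem theorem1:
  fixes I I' :: sched_instance
    and T \<alpha> :: nat
    and S :: "nat \<Rightarrow> nat"
    and \<beta> :: real
  assumes "valid_instance I"
    and "T \<ge> 1"
    and "horizon I = {0..T - 1}"
    and "completes_every_order_by I T"
    and "optimal I S"
    and "\<alpha> > 0"
    and "valid_instance I'"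
    and "num_jobs I' = num_jobs I"
    and "horizon I' = {0..\<alpha> * (T - 1)}"
    and "\<forall>j\<in>jobs I. proc_time I' j = \<alpha> * proc_time I j"
    and "\<forall>j\<in>jobs I. release I' j = \<alpha> * release I j"
    and "\<forall>j\<in>jobs I. \<forall>t\<in>horizon I. start_cost I' j (\<alpha> * t) = \<beta> * start_cost I j t"
  shows "optimal I' (\<lambda>j. \<alpha> * S j)"
proof -
  have jobs: "jobs I' = jobs I"
    using assms(8) by (simp add: jobs_def)
  have div_horizon: "t div \<alpha> \<in> horizon I" if "t \<in> horizon I'" for t
    using that assms(3,6,9) div_le_mono[of t "\<alpha> * (T - 1)" \<alpha>] by simp
  have feas: "feasible I S" and opt: "\<And>R. feasible I R \<Longrightarrow> objective I S \<le> objective I R"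
    using assms(5) by (auto simp: optimal_def is_arg_min_linorder)
  have scaled_cost: "objective I' (\<lambda>j. \<alpha> * R j) = \<beta> * objective I R" if "feasible I R" for R
    using that assms(12) by (simp add: objective_def feasible_def jobs sum_distrib_left)
  have "feasible I' (\<lambda>j. \<alpha> * S j)"
    using assms(1,3,7,9,10,11) jobs feas by (intro feasible_scale_up[of I]) auto
  moreover have "objective I' (\<lambda>j. \<alpha> * S j) \<le> objective I' S'" if S': "feasible I' S'" for S'
  proof (cases "\<beta> \<ge> 0")
    case True
    have feas_div: "feasible I (\<lambda>j. S' j div \<alpha>)"
      using assms(1,6,7,10,11) jobs div_horizon S' by (intro feasible_scale_down[of I I']) auto
    have "objective I' (\<lambda>j. \<alpha> * S j) = \<beta> * objective I S"
      by (rule scaled_cost[OF feas])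
    also have "\<dots> \<le> \<beta> * objective I (\<lambda>j. S' j div \<alpha>)"
      using True opt[OF feas_div] by (rule mult_left_mono[rotated])
    also have "\<dots> = objective I' (\<lambda>j. \<alpha> * (S' j div \<alpha>))"
      by (rule scaled_cost[OF feas_div, symmetric])
    also have "\<dots> \<le> objective I' S'"
      unfolding objective_def
      by (intro sum_mono start_cost_mono assms(7)) auto
    finally show ?thesis .
  next
    case False
    have "start_cost I' j (\<alpha> * S j) \<le> start_cost I' j (S' j)" if j: "j \<in> jobs I" for j
    proof -
      have "start_cost I' j (\<alpha> * S j) = \<beta> * start_cost I j (S j)"
        using assms(12) feas j by (auto simp: feasible_def)
      also have "\<dots> \<le> \<beta> * start_cost I j 0"
        using False start_cost_mono[OF assms(1) j, of 0 "S j"] by (intro mult_left_mono_neg) auto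
      also have "\<dots> = start_cost I' j (\<alpha> * 0)"
        using bspec[OF bspec[OF assms(12) j], of 0] assms(3) by simp
      also have "\<dots> \<le> start_cost I' j (S' j)"
        using j jobs by (intro start_cost_mono assms(7)) auto
      finally show ?thesis .
    qed
    then show ?thesis
      by (auto simp: objective_def jobs intro: sum_mono)
  qed
  ultimately show ?thesis
    by (simp add: optimal_def is_arg_min_linorder)
qed

end
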